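(* Let $\mathscr{H}$ be a complex Hilbert space and let $T\in \mathbb{B}(\mathscr{H})$. Then $$\sqrt{\frac18\|T^*T+TT^*\|+\frac18\left(\|Re(T)+Im(T)\|^2+ \|Re(T)-Im(T)\|^2\right)+ \frac{\beta}4 } \leq w(T),$$ where $\beta=\big|\|Re(T)+Im(T)\|^2- \|Re(T)-Im(T)\|^2\big|$.
   Context: $\mathbb{B}(\mathscr{H})$ denotes the bounded linear operators on $\mathscr{H}$, $\|\cdot\|$ the operator norm. $Re(T)=\frac12(T+T^* )$ and $Im(T)=\frac1{2i}(T-T^* )$. The numerical radius is $w(T)=\sup\{|\langle Tx,x\rangle| : x\in\mathscr{H},\ \|x\|=1\}$. *)

theory Defs
  imports "HOL-Analysis.Analysis"
begin

text \<open>
  Complex inner product spaces. The inner product is linear in the first argument and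
  conjugate-linear in the second one, and the norm (hence the metric and the topology) is the one
  it induces. The real vector space structure is the restriction of the complex one.
\<close>

class complex_inner = real_normed_vector +
  fixes scaleC :: "complex \<Rightarrow> 'a \<Rightarrow> 'a"  (infixr "*\<^sub>C" 75)
    and cinner :: "'a \<Rightarrow> 'a \<Rightarrow> complex"
  assumes scaleC_add_right: "a *\<^sub>C (x + y) = a *\<^sub>C x + a *\<^sub>C y"
    and scaleC_add_left: "(a + b) *\<^sub>C x = a *\<^sub>C x + b *\<^sub>C x"
    and scaleC_scaleC: "a *\<^sub>C (b *\<^sub>C x) = (a * b) *\<^sub>C x"
    and scaleC_of_real: "complex_of_real r *\<^sub>C x = r *\<^sub>R x"
    and cinner_commute: "cinner x y = cnj (cinner y x)"
    and cinner_add_left: "cinner (x + y) z = cinner x z + cinner y z"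
    and cinner_scaleC_left: "cinner (a *\<^sub>C x) y = a * cinner x y"
    and cinner_ge_zero: "0 \<le> Re (cinner x x)"
    and cinner_eq_zero_iff: "cinner x x = 0 \<longleftrightarrow> x = 0"
    and norm_eq_sqrt_cinner: "norm x = sqrt (Re (cinner x x))"

class chilbert_space = complex_inner + complete_space

instantiation complex :: chilbert_space
begin

definition scaleC_complex :: "complex \<Rightarrow> complex \<Rightarrow> complex"
  where "scaleC_complex a x = a * x"

definition cinner_complex :: "complex \<Rightarrow> complex \<Rightarrow> complex"
  where "cinner_complex x y = x * cnj y"

instance
  by standard
    (simp_all add: scaleC_complex_def cinner_complex_def algebra_simps scaleR_conv_of_real
      cmod_def power2_eq_square)

end

locale bounded_clinear = bounded_linear f
  for f :: "'a::complex_inner \<Rightarrow> 'b::complex_inner" +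
  assumes scaleC: "f (a *\<^sub>C x) = a *\<^sub>C f x"

text \<open>
  On a Hilbert space every bounded operator has exactly one adjoint, by the Riesz representation
  theorem. The constant \<open>adjoint\<close> of HOL-Analysis refers to the real inner product instead.
\<close>

definition cadjoint :: "('a::chilbert_space \<Rightarrow> 'a) \<Rightarrow> 'a \<Rightarrow> 'a"
  where "cadjoint T = (THE S. \<forall>x y. cinner (T x) y = cinner x (S y))"

lemma cadjoint_eqI:
  assumes "\<And>x y. cinner (T x) y = cinner x (S y)"
  shows "cadjoint T = S"
  unfolding cadjoint_def
proof (rule the_equality)
  show "\<forall>x y. cinner (T x) y = cinner x (S y)"
    using assms by blast
next
  fix S' assume S': "\<forall>x y. cinner (T x) y = cinner x (S' y)"
  show "S' = S"
  proof
    fix y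
    define d where "d = S' y - S y"
    have "cinner (S' y) d = cinner (S y) d"
      using S' assms by (metis cinner_commute)
    moreover have "cinner (S' y) d = cinner d d + cinner (S y) d"
      using cinner_add_left[of d "S y" d] by (simp add: d_def)
    ultimately have "cinner d d = 0" by simp
    then show "S' y = S y"
      by (simp add: cinner_eq_zero_iff d_def)
  qed
qed

definition op_Re :: "('a::chilbert_space \<Rightarrow> 'a) \<Rightarrow> 'a \<Rightarrow> 'a"
  where "op_Re T = (\<lambda>x. (1 / 2) *\<^sub>C (T x + cadjoint T x))"

definition op_Im :: "('a::chilbert_space \<Rightarrow> 'a) \<Rightarrow> 'a \<Rightarrow> 'a"
  where "op_Im T = (\<lambda>x. (1 / (2 * \<i>)) *\<^sub>C (T x - cadjoint T x))"

text \<open>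
  The supremum is taken among the nonnegative reals. Inserting \<open>0\<close> matters only on the zero space,
  which has no unit vectors: there the supremum of the empty set is \<open>0\<close>, while \<open>Sup {}\<close> is
  unspecified for type \<open>real\<close>.
\<close>

definition numerical_radius :: "('a::chilbert_space \<Rightarrow> 'a) \<Rightarrow> real"
  where "numerical_radius T = Sup (insert 0 {cmod (cinner (T x) x) | x. norm x = 1})"

end

theory Submission
  imports Defs
begin

text \<open>
  For a complex number \<open>c\<close> the operator \<open>P c = c T + cnj c T*\<close> is self-adjoint with quadratic form
  \<open>2 Re (c \<langle>T x, x\<rangle>)\<close>, so its norm is at most \<open>2 |c| w(T)\<close>. Both \<open>Re T + Im T\<close> and \<open>Re T - Im T\<close>
  are of this form with \<open>c = (1 \<mp> \<i>) / 2\<close>, so the squares \<open>a\<close>, \<open>b\<close> of their norms are at most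
  \<open>2 w(T)\<^sup>2\<close>. Moreover \<open>T* T + T T* = (Re T + Im T)\<^sup>2 + (Re T - Im T)\<^sup>2\<close> has norm at most \<open>a + b\<close>.
  Hence the radicand is at most \<open>(a + b) / 4 + |a - b| / 4 = max a b / 2\<close>, which is at most \<open>w(T)\<^sup>2\<close>.
\<close>

section \<open>Inner product calculus and the Cauchy-Schwarz inequality\<close>

lemma cinner_add_right: "cinner x (y + z) = cinner x y + cinner x z"
  for x :: "'a::complex_inner"
  by (metis cinner_add_left cinner_commute complex_cnj_add)

lemma cinner_scaleC_right: "cinner x (a *\<^sub>C y) = cnj a * cinner x y"
  for x :: "'a::complex_inner"
  by (metis cinner_commute cinner_scaleC_left complex_cnj_mult)

lemma cinner_scaleR_left: "cinner (r *\<^sub>R x) y = of_real r * cinner x y"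
  for x :: "'a::complex_inner"
  by (metis cinner_scaleC_left scaleC_of_real)

lemma cinner_scaleR_right: "cinner x (r *\<^sub>R y) = of_real r * cinner x y"
  for x :: "'a::complex_inner"
  by (metis cinner_scaleC_right complex_cnj_complex_of_real scaleC_of_real)

lemma cinner_minus_left: "cinner (- x) y = - cinner x y"
  for x :: "'a::complex_inner"
  using cinner_scaleR_left[of "-1" x y] by simp

lemma cinner_minus_right: "cinner x (- y) = - cinner x y"
  for x :: "'a::complex_inner"
  using cinner_scaleR_right[of x "-1" y] by simp

lemma cinner_diff_left: "cinner (x - y) z = cinner x z - cinner y z"
  for x :: "'a::complex_inner"
  by (metis add_uminus_conv_diff cinner_add_left cinner_minus_left)

lemma cinner_diff_right: "cinner x (y - z) = cinner x y - cinner x z"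
  for x :: "'a::complex_inner"
  by (metis add_uminus_conv_diff cinner_add_right cinner_minus_right)

lemmas cinner_linear = cinner_add_left cinner_add_right cinner_diff_left cinner_diff_right
  cinner_scaleC_left cinner_scaleC_right cinner_scaleR_left cinner_scaleR_right

text \<open>Test with \<open>u - v\<close>. This reduces operator identities to scalar ones, where
  operators can be moved across the inner product.\<close>

lemma cinner_eqI:
  fixes u v :: "'a::complex_inner"
  assumes "\<And>x. cinner x u = cinner x v"
  shows "u = v"
  using assms[of "u - v"] cinner_eq_zero_iff[of "u - v"] by (simp add: cinner_diff_right)

lemma norm_sq_eq_cinner: "(norm x)\<^sup>2 = Re (cinner x x)"
  for x :: "'a::complex_inner"
  by (simp add: norm_eq_sqrt_cinner cinner_ge_zero)

lemma cinner_self: "cinner x x = of_real ((norm x)\<^sup>2)"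
  for x :: "'a::complex_inner"
  using cinner_commute[of x x] by (auto simp: norm_sq_eq_cinner complex_eq_iff)

lemma Re_cinner_commute: "Re (cinner x y) = Re (cinner y x)"
  for x :: "'a::complex_inner"
  by (metis cinner_commute complex_cnj(1) complex.sel(1) cnj.sel(1))

lemma norm_add_sq: "(norm (x + y))\<^sup>2 = (norm x)\<^sup>2 + 2 * Re (cinner x y) + (norm y)\<^sup>2"
  for x :: "'a::complex_inner"
  using Re_cinner_commute[of x y] by (simp add: norm_sq_eq_cinner cinner_linear)

lemma parallelogram_law:
  "(norm (x + y))\<^sup>2 + (norm (x - y))\<^sup>2 = 2 * (norm x)\<^sup>2 + 2 * (norm y)\<^sup>2"
  for x :: "'a::complex_inner"
  by (simp add: norm_sq_eq_cinner cinner_linear)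

lemma norm_scaleC: "norm (a *\<^sub>C x) = cmod a * norm x"
  for x :: "'a::complex_inner"
proof -
  have "cinner (a *\<^sub>C x) (a *\<^sub>C x) = a * cnj a * cinner x x"
    by (simp add: cinner_linear)
  also have "\<dots> = of_real ((cmod a * norm x)\<^sup>2)"
    by (simp only: cinner_self complex_norm_square power_mult_distrib of_real_mult flip: of_real_power)
  finally have "(norm (a *\<^sub>C x))\<^sup>2 = (cmod a * norm x)\<^sup>2"
    by (metis cinner_self of_real_eq_iff)
  then show ?thesis
    by (simp add: power2_eq_iff_nonneg)
qed

text \<open>Squaring the triangle inequality, which the class already provides, leaves exactly this
  cross term.\<close>

lemma Re_cinner_le: "Re (cinner x y) \<le> norm x * norm y"
  for x :: "'a::complex_inner"
proof -
  have "(norm (x + y))\<^sup>2 \<le> (norm x + norm y)\<^sup>2"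
    by (simp add: norm_triangle_ineq power_mono)
  then show ?thesis
    by (simp add: norm_add_sq power2_sum)
qed

text \<open>Rotating \<open>x\<close> by a unimodular phase makes the inner product real and
  nonnegative, so the bound on real parts applies.\<close>

lemma cmod_cinner_le: "cmod (cinner x y) \<le> norm x * norm y"
  for x :: "'a::complex_inner"
proof (cases "cinner x y = 0")
  case False
  define c where "c = cnj (cinner x y) / of_real (cmod (cinner x y))"
  have "c * cinner x y = cinner x y * cnj (cinner x y) / of_real (cmod (cinner x y))"
    by (simp add: c_def)
  also have "\<dots> = of_real (cmod (cinner x y))"
    using False by (simp add: power2_eq_square flip: complex_norm_square)
  finally have "c * cinner x y = of_real (cmod (cinner x y))" .
  then have "cmod (cinner x y) = Re (cinner (c *\<^sub>C x) y)"
    by (simp add: cinner_scaleC_left)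
  also have "\<dots> \<le> norm (c *\<^sub>C x) * norm y"
    by (rule Re_cinner_le)
  also have "\<dots> = norm x * norm y"
    using False by (simp add: norm_scaleC c_def norm_divide)
  finally show ?thesis .
qed simp

section \<open>Riesz representation and existence of the adjoint\<close>

text \<open>The representing vector minimises \<open>\<parallel>y\<parallel>\<^sup>2 - 2 g(y)\<close>: by the parallelogram law minimising
  sequences are Cauchy, and the first variation vanishes at a minimiser.\<close>

lemma riesz_real:
  fixes g :: "'a::chilbert_space \<Rightarrow> real"
  assumes g: "bounded_linear g"
  shows "\<exists>z. \<forall>x. g x = Re (cinner x z)"
proof -
  interpret g: bounded_linear g by (rule g)
  define J where "J y = (norm y)\<^sup>2 - 2 * g y" for y
  obtain K where K: "\<And>x. norm (g x) \<le> norm x * K"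
    using g.bounded by blast
  \<comment> \<open>Complete the square: \<open>J y\<close> is at least
    \<open>(norm y - K)\<^sup>2 - K\<^sup>2\<close>.\<close>
  have J_lower: "- K\<^sup>2 \<le> J y" for y
  proof -
    have "g y \<le> norm y * K" using K[of y] by simp
    moreover have "0 \<le> (norm y - K)\<^sup>2" by simp
    ultimately show ?thesis by (simp add: J_def power2_diff)
  qed
  then have bdd: "bdd_below (range J)" by (intro bdd_belowI2)
  define m where "m = Inf (range J)"
  have m_le: "m \<le> J y" for y
    unfolding m_def using bdd by (simp add: cInf_lower)
  have "\<exists>y. J y < m + e" if "e > 0" for e
    using cInf_lessD[of "range J" "m + e"] that by (auto simp: m_def)
  then have "\<exists>y. J y < m + inverse (real (Suc n))" for n by simp
  then obtain X where X: "\<And>n. J (X n) < m + inverse (real (Suc n))" by metis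
  \<comment> \<open>The midpoint of \<open>x\<close> and \<open>y\<close> also has
    \<open>J\<close>-value at least \<open>m\<close>, so two near-minimisers are close to each
    other.\<close>
  have J_mid: "(norm (x - y))\<^sup>2 \<le> 2 * (J x - m) + 2 * (J y - m)" for x y
  proof -
    have "(norm ((1/2) *\<^sub>R (x + y)))\<^sup>2 = (norm (x + y))\<^sup>2 / 4"
      by (simp only: norm_scaleR power_mult_distrib) (simp add: power2_eq_square)
    moreover have "g ((1/2) *\<^sub>R (x + y)) = (g x + g y) / 2"
      by (simp only: g.scaleR g.add) simp
    ultimately have "(norm (x - y))\<^sup>2 = 2 * J x + 2 * J y - 4 * J ((1/2) *\<^sub>R (x + y))"
      using parallelogram_law[of x y] unfolding J_def by argo
    then show ?thesis using m_le[of "(1/2) *\<^sub>R (x + y)"] by simp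
  qed
  have "Cauchy X"
  proof (rule metric_CauchyI)
    fix e :: real assume "e > 0"
    then obtain N where N: "inverse (real (Suc N)) < e\<^sup>2 / 4"
      using reals_Archimedean[of "e\<^sup>2 / 4"] by auto
    have near: "J (X n) - m < e\<^sup>2 / 4" if "n \<ge> N" for n
    proof -
      have "inverse (real (Suc n)) \<le> inverse (real (Suc N))" using that by simp
      then show ?thesis using X[of n] N by linarith
    qed
    have "dist (X i) (X j) < e" if "i \<ge> N" "j \<ge> N" for i j
    proof (rule power2_less_imp_less)
      show "(dist (X i) (X j))\<^sup>2 < e\<^sup>2"
        using J_mid[of "X i" "X j"] near[OF that(1)] near[OF that(2)] by (simp add: dist_norm)
    qed (use \<open>e > 0\<close> in simp)
    then show "\<exists>M. \<forall>i\<ge>M. \<forall>j\<ge>M. dist (X i) (X j) < e" by blast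
  qed
  then obtain z where z: "X \<longlonglongrightarrow> z"
    using Cauchy_convergent_iff convergent_def by blast
  have "(\<lambda>n. J (X n)) \<longlonglongrightarrow> J z"
    unfolding J_def by (intro tendsto_intros g.tendsto z)
  moreover have "(\<lambda>n. m + inverse (real (Suc n))) \<longlonglongrightarrow> m + 0"
    by (intro tendsto_intros LIMSEQ_inverse_real_of_nat)
  ultimately have "J z \<le> m + 0"
    by (rule LIMSEQ_le) (use X less_imp_le in blast)
  then have z_min: "J z \<le> J y" for y using m_le[of y] by simp
  have "g y = Re (cinner y z)" for y
  proof (rule ccontr)
    define d where "d = Re (cinner z y) - g y"
    assume "g y \<noteq> Re (cinner y z)"
    then have "d \<noteq> 0" by (simp add: d_def Re_cinner_commute)
    have var: "0 \<le> t\<^sup>2 * (norm y)\<^sup>2 + 2 * t * d" for t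
      using z_min[of "z + t *\<^sub>R y"]
      by (simp add: J_def norm_add_sq g.add g.scaleR cinner_scaleR_right d_def
          power_mult_distrib algebra_simps)
    \<comment> \<open>With \<open>t = - d / s\<close> the variation is a square times
      \<open>(norm y)\<^sup>2 - 2 * s\<close>. The added 1 keeps \<open>s\<close> positive without a
      case split on \<open>y\<close>.\<close>
    define s where "s = (norm y)\<^sup>2 + 1"
    have "s > 0" "(norm y)\<^sup>2 - 2 * s < 0"
      using zero_le_power2[of "norm y"] by (unfold s_def) (linarith, smt (verit))
    have "0 \<le> (- d / s)\<^sup>2 * (norm y)\<^sup>2 + 2 * (- d / s) * d" by (rule var)
    also have "\<dots> = (d / s)\<^sup>2 * ((norm y)\<^sup>2 - 2 * s)"
      using \<open>s > 0\<close> by (simp add: field_simps power2_eq_square)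
    also have "\<dots> < 0"
      using \<open>d \<noteq> 0\<close> \<open>s > 0\<close> \<open>(norm y)\<^sup>2 - 2 * s < 0\<close> by (intro mult_pos_neg) auto
    finally show False by simp
  qed
  then show ?thesis by blast
qed

text \<open>\<open>cadjoint\<close> is a definite description, so a witness must be built: for each
  \<open>y\<close>, Riesz represents the real functional \<open>Re (cinner (T x) y)\<close>, and
  complex linearity recovers the imaginary part.\<close>

lemma cinner_cadjoint:
  fixes T :: "'a::chilbert_space \<Rightarrow> 'a"
  assumes "bounded_clinear T"
  shows "cinner (T x) y = cinner x (cadjoint T y)"
proof -
  interpret T: bounded_clinear T by (rule assms)
  have "\<exists>z. \<forall>x. cinner (T x) y = cinner x z" for y
  proof -
    have "bounded_linear (\<lambda>x. Re (cinner (T x) y))"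
    proof (rule bounded_linear_intro)
      show "norm (Re (cinner (T x) y)) \<le> norm x * (onorm T * norm y)" for x
      proof -
        have "\<bar>Re (cinner (T x) y)\<bar> \<le> norm (T x) * norm y"
          using abs_Re_le_cmod cmod_cinner_le order_trans by blast
        also have "\<dots> \<le> onorm T * norm x * norm y"
          by (intro mult_right_mono onorm T.bounded_linear_axioms) simp
        finally show ?thesis by (simp add: ac_simps)
      qed
    qed (simp_all add: T.add T.scaleR cinner_linear)
    then obtain z where z: "\<And>x. Re (cinner (T x) y) = Re (cinner x z)"
      using riesz_real by blast
    \<comment> \<open>Replacing \<open>x\<close> by \<open>\<i> *\<^sub>C x\<close> turns real parts
      into negated imaginary parts.\<close>
    have "Im (cinner (T x) y) = Im (cinner x z)" for x
      using z[of "\<i> *\<^sub>C x"] by (simp add: T.scaleC cinner_scaleC_left)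
    with z show ?thesis by (auto simp: complex_eq_iff)
  qed
  then obtain S where S: "\<And>x y. cinner (T x) y = cinner x (S y)" by metis
  then have "cadjoint T = S" by (rule cadjoint_eqI)
  with S show ?thesis by simp
qed

lemma cinner_cadjoint':
  fixes T :: "'a::chilbert_space \<Rightarrow> 'a"
  assumes "bounded_clinear T"
  shows "cinner (cadjoint T x) y = cinner x (T y)"
  by (metis assms cinner_cadjoint cinner_commute)

section \<open>Self-adjoint operators and the numerical radius\<close>

text \<open>Polarization expresses \<open>Re (cinner (S x) y)\<close> through the quadratic form;
  taking \<open>y\<close> along \<open>S x\<close> then gives the norm. Additivity of
  \<open>S\<close> is itself a consequence of symmetry.\<close>

lemma norm_le_of_self_adjoint:
  fixes S :: "'a::complex_inner \<Rightarrow> 'a"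
  assumes sym: "\<And>x y. cinner (S x) y = cinner x (S y)"
    and M: "\<And>x. \<bar>Re (cinner (S x) x)\<bar> \<le> M * (norm x)\<^sup>2"
  shows "norm (S x) \<le> M * norm x"
proof (cases "x = 0 \<or> S x = 0")
  case True
  have "0 \<le> M" if "x \<noteq> 0"
    using M[of x] that by (smt (verit) mult_neg_pos zero_less_norm_iff zero_less_power)
  moreover have "S x = 0" if "x = 0"
  proof (rule cinner_eqI)
    show "cinner y (S x) = cinner y 0" for y
      using sym[of y 0] cinner_diff_right[of y 0 0] cinner_diff_right[of "S y" 0 0] that by simp
  qed
  ultimately show ?thesis using True by fastforce
next
  case False
  have polar: "2 * Re (cinner (S x) y) \<le> M * ((norm x)\<^sup>2 + (norm y)\<^sup>2)" for y
  proof -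
    have add: "S (u + v) = S u + S v" for u v
      by (rule cinner_eqI) (simp add: sym[symmetric] cinner_add_right)
    have diff: "S (u - v) = S u - S v" for u v
      by (rule cinner_eqI) (simp add: sym[symmetric] cinner_diff_right)
    have "Re (cinner (S y) x) = Re (cinner (S x) y)"
      by (metis sym Re_cinner_commute)
    then have "4 * Re (cinner (S x) y)
        = Re (cinner (S (x + y)) (x + y)) - Re (cinner (S (x - y)) (x - y))"
      by (simp add: add diff cinner_linear)
    also have "\<dots> \<le> M * ((norm (x + y))\<^sup>2 + (norm (x - y))\<^sup>2)"
      using M[of "x + y"] M[of "x - y"] by (simp add: distrib_left)
    finally show ?thesis by (simp add: parallelogram_law distrib_left)
  qed
  \<comment> \<open>This scaling gives \<open>r *\<^sub>R S x\<close> the norm of \<open>x\<close>,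
    which balances the two squares in \<open>polar\<close>.\<close>
  define r where "r = norm x / norm (S x)"
  have "2 * (r * (norm (S x))\<^sup>2) \<le> M * ((norm x)\<^sup>2 + (r * norm (S x))\<^sup>2)"
    using polar[of "r *\<^sub>R S x"] by (simp add: cinner_linear cinner_self r_def power_mult_distrib)
  then have "(norm x) * norm (S x) \<le> norm x * (M * norm x)"
    using False by (simp add: r_def power2_eq_square algebra_simps)
  then show ?thesis using False by simp
qed

text \<open>Cauchy-Schwarz bounds the set by \<open>onorm T\<close>, so its supremum dominates every
  element; the quadratic form is homogeneous of degree two, which passes from unit vectors to all
  vectors.\<close>

lemma numerical_radius_bound:
  fixes T :: "'a::chilbert_space \<Rightarrow> 'a"
  assumes "bounded_clinear T"
  shows "cmod (cinner (T x) x) \<le> numerical_radius T * (norm x)\<^sup>2"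
    and "0 \<le> numerical_radius T"
proof -
  interpret T: bounded_clinear T by (rule assms)
  let ?W = "insert 0 {cmod (cinner (T x) x) | x. norm x = 1}"
  have "cmod (cinner (T x) x) \<le> onorm T" if "norm x = 1" for x
    using cmod_cinner_le[of "T x" x] onorm[OF T.bounded_linear_axioms, of x] that by simp
  then have bdd: "bdd_above ?W"
    by (intro bdd_aboveI[of _ "onorm T"]) (auto simp: onorm_pos_le T.bounded_linear_axioms)
  then show "0 \<le> numerical_radius T"
    unfolding numerical_radius_def by (intro cSup_upper) auto
  have unit: "cmod (cinner (T u) u) \<le> numerical_radius T" if "norm u = 1" for u
    unfolding numerical_radius_def using bdd that by (intro cSup_upper) auto
  show "cmod (cinner (T x) x) \<le> numerical_radius T * (norm x)\<^sup>2"
  proof (cases "x = 0")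
    case True
    then show ?thesis by (simp add: T.zero cinner_self)
  next
    case False
    define u where "u = inverse (norm x) *\<^sub>R x"
    have "norm u = 1" and x: "x = norm x *\<^sub>R u"
      using False by (simp_all add: u_def)
    have "cinner (T (norm x *\<^sub>R u)) (norm x *\<^sub>R u) = of_real ((norm x)\<^sup>2) * cinner (T u) u"
      by (simp only: T.scaleR cinner_linear power2_eq_square of_real_mult mult.assoc)
    then have "cinner (T x) x = of_real ((norm x)\<^sup>2) * cinner (T u) u"
      by (simp only: x[symmetric])
    then have "cmod (cinner (T x) x) = cmod (cinner (T u) u) * (norm x)\<^sup>2"
      by (simp add: norm_mult norm_power)
    then show ?thesis
      using unit[OF \<open>norm u = 1\<close>] by (simp add: mult_right_mono)
  qed
qed

section \<open>The self-adjoint combinations of \<open>T\<close> and its adjoint\<close>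

text \<open>This is twice the real part of the operator \<open>c T\<close>.\<close>

definition herm_comb :: "('a::chilbert_space \<Rightarrow> 'a) \<Rightarrow> complex \<Rightarrow> 'a \<Rightarrow> 'a"
  where "herm_comb T c = (\<lambda>x. c *\<^sub>C T x + cnj c *\<^sub>C cadjoint T x)"

context
  fixes T :: "'a::chilbert_space \<Rightarrow> 'a"
  assumes T: "bounded_clinear T"
begin

lemma herm_comb_self_adjoint: "cinner (herm_comb T c x) y = cinner x (herm_comb T c y)"
  by (simp add: herm_comb_def cinner_linear cinner_cadjoint[OF T] cinner_cadjoint'[OF T])

lemma norm_herm_comb_le:
  "norm (herm_comb T c x) \<le> 2 * cmod c * numerical_radius T * norm x"
proof (rule norm_le_of_self_adjoint)
  show "\<bar>Re (cinner (herm_comb T c x) x)\<bar> \<le> 2 * cmod c * numerical_radius T * (norm x)\<^sup>2" for x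
  proof -
    have "cinner (cadjoint T x) x = cnj (cinner (T x) x)"
      using cinner_cadjoint'[OF T] cinner_commute by metis
    then have "Re (cinner (herm_comb T c x) x) = 2 * Re (c * cinner (T x) x)"
      by (simp add: herm_comb_def cinner_linear)
    moreover have "\<bar>Re (c * cinner (T x) x)\<bar> \<le> cmod c * cmod (cinner (T x) x)"
      using abs_Re_le_cmod norm_mult by metis
    moreover have "\<dots> \<le> cmod c * (numerical_radius T * (norm x)\<^sup>2)"
      by (intro mult_left_mono numerical_radius_bound T) simp
    ultimately show ?thesis by simp
  qed
qed (rule herm_comb_self_adjoint)

text \<open>Linearity comes from moving the operator to the other side of the inner product,
  boundedness from the numerical radius estimate. It makes \<open>onorm\<close> a true bound for
  these operators.\<close>

lemma bounded_linear_herm_comb: "bounded_linear (herm_comb T c)"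
proof (rule bounded_linear_intro)
  show "herm_comb T c (x + y) = herm_comb T c x + herm_comb T c y" for x y
    by (rule cinner_eqI) (simp add: cinner_linear flip: herm_comb_self_adjoint)
  show "herm_comb T c (r *\<^sub>R x) = r *\<^sub>R herm_comb T c x" for r x
    by (rule cinner_eqI) (simp add: cinner_linear flip: herm_comb_self_adjoint)
  show "norm (herm_comb T c x) \<le> norm x * (2 * cmod c * numerical_radius T)" for x
    using norm_herm_comb_le[of c x] by (simp add: ac_simps)
qed

lemma onorm_herm_comb_sq_le: "(onorm (herm_comb T c))\<^sup>2 \<le> 4 * (cmod c)\<^sup>2 * (numerical_radius T)\<^sup>2"
proof -
  have "onorm (herm_comb T c) \<le> 2 * cmod c * numerical_radius T"
    by (intro onorm_bound norm_herm_comb_le) (simp add: numerical_radius_bound T)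
  then have "(onorm (herm_comb T c))\<^sup>2 \<le> (2 * cmod c * numerical_radius T)\<^sup>2"
    by (intro power_mono) (simp_all add: onorm_pos_le bounded_linear_herm_comb)
  then show ?thesis by (simp add: power_mult_distrib)
qed

text \<open>The hypothesis says that \<open>c\<^sup>2\<close> is purely imaginary, which cancels the
  contributions of \<open>T\<^sup>2\<close> and of the squared adjoint in the sum of the two
  squares.\<close>

lemma herm_comb_squares:
  assumes "c\<^sup>2 + (cnj c)\<^sup>2 = 0"
  shows "herm_comb T c (herm_comb T c x) + herm_comb T (cnj c) (herm_comb T (cnj c) x)
    = (2 * (c * cnj c)) *\<^sub>C (cadjoint T (T x) + T (cadjoint T x))"
proof (rule cinner_eqI)
  fix y
  define p where "p = cinner (T y) (T x)"
  define q where "q = cinner (cadjoint T y) (cadjoint T x)"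
  define r where "r = cinner (T y) (cadjoint T x)"
  define s where "s = cinner (cadjoint T y) (T x)"
  have "cinner y (herm_comb T c (herm_comb T c x)
      + herm_comb T (cnj c) (herm_comb T (cnj c) x))
    = cinner (herm_comb T c y) (herm_comb T c x)
      + cinner (herm_comb T (cnj c) y) (herm_comb T (cnj c) x)"
    by (simp add: cinner_add_right herm_comb_self_adjoint)
  \<comment> \<open>The mixed terms are \<open>c\<^sup>2 * r + (cnj c)\<^sup>2 * s\<close> from the
    first product, and the same with \<open>c\<close> and \<open>cnj c\<close> exchanged from the
    second.\<close>
  also have "\<dots> = 2 * (c * cnj c) * (p + q) + (c\<^sup>2 + (cnj c)\<^sup>2) * (r + s)"
    by (simp add: herm_comb_def cinner_linear p_def q_def r_def s_def power2_eq_square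
        algebra_simps)
  also have "\<dots> = 2 * (c * cnj c) * (p + q)"
    by (simp add: assms)
  also have "\<dots> = cinner y ((2 * (c * cnj c)) *\<^sub>C (cadjoint T (T x) + T (cadjoint T x)))"
    by (simp add: cinner_linear p_def q_def cinner_cadjoint[OF T] cinner_cadjoint'[OF T]
        algebra_simps)
  finally show "cinner y (herm_comb T c (herm_comb T c x)
      + herm_comb T (cnj c) (herm_comb T (cnj c) x)) = \<dots>" .
qed

end

theorem corollary2p7:
  fixes T :: "'a::chilbert_space \<Rightarrow> 'a" and \<beta> :: real
  assumes "bounded_clinear T"
  defines "\<beta> \<equiv> \<bar>(onorm (\<lambda>x. op_Re T x + op_Im T x))\<^sup>2 - (onorm (\<lambda>x. op_Re T x - op_Im T x))\<^sup>2\<bar>"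
  shows "sqrt (1 / 8 * onorm (\<lambda>x. cadjoint T (T x) + T (cadjoint T x))
             + 1 / 8 * ((onorm (\<lambda>x. op_Re T x + op_Im T x))\<^sup>2
                        + (onorm (\<lambda>x. op_Re T x - op_Im T x))\<^sup>2)
             + \<beta> / 4)
         \<le> numerical_radius T"
proof -
  \<comment> \<open>\<open>c\<close> is the coefficient \<open>1/2 + 1/(2 * \<i>)\<close> of
    \<open>T\<close> in \<open>Re T + Im T\<close>, and the adjoint has coefficient
    \<open>cnj c\<close>. In \<open>Re T - Im T\<close> the two are exchanged.\<close>
  define c :: complex where "c = (1 - \<i>) / 2"
  let ?P = "herm_comb T c" and ?Q = "herm_comb T (cnj c)"
  let ?w = "numerical_radius T"
  let ?N = "\<lambda>x. cadjoint T (T x) + T (cadjoint T x)"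
  note T = \<open>bounded_clinear T\<close>
  have c: "c\<^sup>2 + (cnj c)\<^sup>2 = 0" "2 * (c * cnj c) = 1" "(cmod c)\<^sup>2 = 1 / 2"
    by (simp_all add: c_def complex_eq_iff power2_eq_square cmod_def)
  have half_i: "1 / (2 * \<i>) = - \<i> / 2"
    by (simp add: complex_eq_iff)
  have P: "(\<lambda>x. op_Re T x + op_Im T x) = ?P"
    unfolding op_Im_def half_i
    by (rule ext, rule cinner_eqI)
      (simp add: op_Re_def herm_comb_def cinner_linear c_def
        complex_eq_iff algebra_simps add_divide_distrib diff_divide_distrib)
  have Q: "(\<lambda>x. op_Re T x - op_Im T x) = ?Q"
    unfolding op_Im_def half_i
    by (rule ext, rule cinner_eqI)
      (simp add: op_Re_def herm_comb_def cinner_linear c_def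
        complex_eq_iff algebra_simps add_divide_distrib diff_divide_distrib)
  define a where "a = (onorm ?P)\<^sup>2"
  define b where "b = (onorm ?Q)\<^sup>2"
  have a: "a \<le> 2 * ?w\<^sup>2" and b: "b \<le> 2 * ?w\<^sup>2"
    using onorm_herm_comb_sq_le[OF T, of c] onorm_herm_comb_sq_le[OF T, of "cnj c"]
    by (simp_all add: a_def b_def c)
  have sq: "norm (herm_comb T d (herm_comb T d x)) \<le> (onorm (herm_comb T d))\<^sup>2 * norm x" for d x
  proof -
    note bl = bounded_linear_herm_comb[OF T, of d]
    have "norm (herm_comb T d (herm_comb T d x)) \<le> onorm (herm_comb T d) * norm (herm_comb T d x)"
      by (rule onorm[OF bl])
    also have "\<dots> \<le> onorm (herm_comb T d) * (onorm (herm_comb T d) * norm x)"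
      by (intro mult_left_mono onorm bl onorm_pos_le)
    finally show ?thesis by (simp add: power2_eq_square)
  qed
  have "onorm ?N \<le> a + b"
  proof (rule onorm_bound)
    fix x
    \<comment> \<open>Since \<open>2 * (c * cnj c) = 1\<close>, the scalar in the sum of squares
      disappears.\<close>
    have "?N x = ?P (?P x) + ?Q (?Q x)"
      using herm_comb_squares[OF T c(1), of x] scaleC_of_real[of 1 "?N x"] by (simp add: c(2))
    then show "norm (?N x) \<le> (a + b) * norm x"
      using norm_triangle_ineq[of "?P (?P x)" "?Q (?Q x)"] sq[of c x] sq[of "cnj c" x]
      by (simp add: a_def b_def distrib_right)
  qed (simp add: a_def b_def)
  then have "1 / 8 * onorm ?N + 1 / 8 * (a + b) + \<bar>a - b\<bar> / 4 \<le> ?w\<^sup>2"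
    using a b by (cases "a \<le> b") (simp_all add: field_simps)
  then show ?thesis
    unfolding \<beta>_def P Q a_def b_def
    by (intro real_le_lsqrt) (simp_all add: numerical_radius_bound T)
qed

end
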